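(* Assume that the knowledge bases considered are finite and effectively listable under a fixed canonical order, and that for each such knowledge base $S_O$ the predicate $s\in\mathrm{Cn}(\Gamma)$ is decidable whenever $\Gamma\subseteq S_O$ is finite and $s\in S_O$. Then for every finite knowledge base $S_O$, the set $A:=\mathrm{Atom}(S_O)$ satisfies: (i) (closure equivalence) $\mathrm{Cn}(A)=\mathrm{Cn}(S_O)$; (ii) (irredundancy) for every $a\in A$, $a\notin\mathrm{Cn}(A\setminus\{a\})$; (iii) (canonicality) $\mathrm{Atom}(S_O)$ is uniquely determined by $S_O$ and the fixed canonical order.
   Context: $\mathcal L$ is many-sorted first-order logic with least fixed-point operators FO(LFP). $\mathcal P$ is a fixed effective proof system for $\mathcal L$ with decidable proof checking; for a finite set $\Gamma$ of formulas, $\Gamma\vdash\varphi$ means that $\varphi$ is derivable from $\Gamma$ in $\mathcal P$ (in the usual sense), and $\mathrm{Cn}(\Gamma)=\{\varphi:\Gamma\vdash\varphi\}$ is the deductive closure operator. A knowledge base $S_O$ is a finite set of formulas of $\mathcal L$. $\mathrm{Atom}(S_O)$ is the output of the following deterministic procedure: initialize $A\leftarrow S_O$; scan the elements $s\in S_O$ in the fixed canonical order, and for each $s$, if $s\in\mathrm{Cn}(A\setminus\{s\})$ (for the current $A$), set $A\leftarrow A\setminus\{s\}$; output the final $A$. *)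

theory Defs
  imports "HOL-Library.Nat_Bijection"
begin

section \<open>Syntax of many-sorted FO(LFP)\<close>

text \<open>Sorts, function symbols, relation symbols and variable names are natural numbers, so that
  formulas can be Goedel-numbered. An individual variable is a pair of its sort and its name, and a
  relation variable is a pair of its name and the list of its argument sorts.\<close>

type_synonym var = "nat \<times> nat"
type_synonym rvar = "nat \<times> nat list"

record signature =
  sorts :: "nat set"
  fun_rank :: "nat \<Rightarrow> (nat list \<times> nat) option"
  rel_rank :: "nat \<Rightarrow> nat list option"

definition wf_signature :: "signature \<Rightarrow> bool" where
  "wf_signature \<Sigma> \<longleftrightarrow>
     sorts \<Sigma> \<noteq> {} \<and>
     (\<forall>f ss s. fun_rank \<Sigma> f = Some (ss, s) \<longrightarrow> set ss \<subseteq> sorts \<Sigma> \<and> s \<in> sorts \<Sigma>) \<and>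
     (\<forall>r ss. rel_rank \<Sigma> r = Some ss \<longrightarrow> set ss \<subseteq> sorts \<Sigma>)"

datatype tm = Var var | Fn nat "tm list"

text \<open>\<open>Lfp X xs \<phi> ts\<close> is the formula \<open>[lfp (X, xs). \<phi>](ts)\<close>; the sorts of \<open>xs\<close> are the argument
  sorts of the bound relation variable, whose name is \<open>X\<close>.\<close>

datatype fm =
    Falsum
  | Eq tm tm
  | Rel nat "tm list"
  | RVar rvar "tm list"
  | Neg fm
  | Conj fm fm
  | Disj fm fm
  | Impl fm fm
  | All var fm
  | Ex var fm
  | Lfp nat "var list" fm "tm list"

inductive has_sort :: "signature \<Rightarrow> tm \<Rightarrow> nat \<Rightarrow> bool" for \<Sigma> where
  has_sort_Var: "s \<in> sorts \<Sigma> \<Longrightarrow> has_sort \<Sigma> (Var (s, x)) s"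
| has_sort_Fn: "fun_rank \<Sigma> f = Some (ss, s) \<Longrightarrow> list_all2 (has_sort \<Sigma>) ts ss \<Longrightarrow> has_sort \<Sigma> (Fn f ts) s"

text \<open>\<open>polar \<phi> X True\<close>: all free occurrences of \<open>X\<close> in \<open>\<phi>\<close> are positive;
  \<open>polar \<phi> X False\<close>: all of them are negative.\<close>

primrec polar :: "fm \<Rightarrow> rvar \<Rightarrow> bool \<Rightarrow> bool" where
  "polar Falsum X b = True"
| "polar (Eq t u) X b = True"
| "polar (Rel r ts) X b = True"
| "polar (RVar Y ts) X b = (Y = X \<longrightarrow> b)"
| "polar (Neg \<phi>) X b = polar \<phi> X (\<not> b)"
| "polar (Conj \<phi> \<psi>) X b = (polar \<phi> X b \<and> polar \<psi> X b)"
| "polar (Disj \<phi> \<psi>) X b = (polar \<phi> X b \<and> polar \<psi> X b)"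
| "polar (Impl \<phi> \<psi>) X b = (polar \<phi> X (\<not> b) \<and> polar \<psi> X b)"
| "polar (All x \<phi>) X b = polar \<phi> X b"
| "polar (Ex x \<phi>) X b = polar \<phi> X b"
| "polar (Lfp Y xs \<phi> ts) X b = ((Y, map fst xs) = X \<or> polar \<phi> X b)"

primrec wf_fm :: "signature \<Rightarrow> fm \<Rightarrow> bool" where
  "wf_fm \<Sigma> Falsum = True"
| "wf_fm \<Sigma> (Eq t u) = (\<exists>s. has_sort \<Sigma> t s \<and> has_sort \<Sigma> u s)"
| "wf_fm \<Sigma> (Rel r ts) = (\<exists>ss. rel_rank \<Sigma> r = Some ss \<and> list_all2 (has_sort \<Sigma>) ts ss)"
| "wf_fm \<Sigma> (RVar X ts) = (set (snd X) \<subseteq> sorts \<Sigma> \<and> list_all2 (has_sort \<Sigma>) ts (snd X))"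
| "wf_fm \<Sigma> (Neg \<phi>) = wf_fm \<Sigma> \<phi>"
| "wf_fm \<Sigma> (Conj \<phi> \<psi>) = (wf_fm \<Sigma> \<phi> \<and> wf_fm \<Sigma> \<psi>)"
| "wf_fm \<Sigma> (Disj \<phi> \<psi>) = (wf_fm \<Sigma> \<phi> \<and> wf_fm \<Sigma> \<psi>)"
| "wf_fm \<Sigma> (Impl \<phi> \<psi>) = (wf_fm \<Sigma> \<phi> \<and> wf_fm \<Sigma> \<psi>)"
| "wf_fm \<Sigma> (All x \<phi>) = (fst x \<in> sorts \<Sigma> \<and> wf_fm \<Sigma> \<phi>)"
| "wf_fm \<Sigma> (Ex x \<phi>) = (fst x \<in> sorts \<Sigma> \<and> wf_fm \<Sigma> \<phi>)"
| "wf_fm \<Sigma> (Lfp X xs \<phi> ts) =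
     (distinct xs \<and> set (map fst xs) \<subseteq> sorts \<Sigma> \<and> list_all2 (has_sort \<Sigma>) ts (map fst xs) \<and>
      wf_fm \<Sigma> \<phi> \<and> polar \<phi> (X, map fst xs) True)"

definition formulas :: "signature \<Rightarrow> fm set" where
  "formulas \<Sigma> = {\<phi>. wf_fm \<Sigma> \<phi>}"

definition knowledge_base :: "signature \<Rightarrow> fm set \<Rightarrow> bool" where
  "knowledge_base \<Sigma> S \<longleftrightarrow> finite S \<and> S \<subseteq> formulas \<Sigma>"


section \<open>Computability\<close>

text \<open>Partial recursive functions; \<open>eval_rec f xs y\<close> says that \<open>f\<close> halts on input \<open>xs\<close> with output \<open>y\<close>.\<close>

datatype recf = Zero | Succ | Proj nat | Comp recf "recf list" | Prim recf recf | Min recf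

inductive eval_rec :: "recf \<Rightarrow> nat list \<Rightarrow> nat \<Rightarrow> bool" where
  "eval_rec Zero xs 0"
| "eval_rec Succ [x] (Suc x)"
| "i < length xs \<Longrightarrow> eval_rec (Proj i) xs (xs ! i)"
| "list_all2 (\<lambda>g y. eval_rec g xs y) gs ys \<Longrightarrow> eval_rec f ys z \<Longrightarrow> eval_rec (Comp f gs) xs z"
| "eval_rec f xs y \<Longrightarrow> eval_rec (Prim f g) (0 # xs) y"
| "eval_rec (Prim f g) (n # xs) y \<Longrightarrow> eval_rec g (n # y # xs) z \<Longrightarrow> eval_rec (Prim f g) (Suc n # xs) z"
| "eval_rec f (n # xs) 0 \<Longrightarrow> (\<forall>m<n. \<exists>y. eval_rec f (m # xs) (Suc y)) \<Longrightarrow> eval_rec (Min f) xs n"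

definition computable_on :: "nat set \<Rightarrow> (nat \<Rightarrow> nat) \<Rightarrow> bool" where
  "computable_on D h \<longleftrightarrow> (\<exists>f. \<forall>x\<in>D. eval_rec f [x] (h x))"

text \<open>The question whether \<open>x \<in> B\<close> is decidable for inputs \<open>x\<close> restricted to \<open>D\<close>.\<close>

definition decidable_on :: "nat set \<Rightarrow> nat set \<Rightarrow> bool" where
  "decidable_on D B \<longleftrightarrow> computable_on D (\<lambda>x. if x \<in> B then 1 else 0)"

abbreviation decidable :: "nat set \<Rightarrow> bool" where
  "decidable \<equiv> decidable_on UNIV"

inductive_cases eval_rec_ZeroE: "eval_rec Zero xs y"
inductive_cases eval_rec_SuccE: "eval_rec Succ xs y"
inductive_cases eval_rec_ProjE: "eval_rec (Proj i) xs y"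
inductive_cases eval_rec_CompE: "eval_rec (Comp f gs) xs y"
inductive_cases eval_rec_Prim0E: "eval_rec (Prim f g) (0 # xs) y"
inductive_cases eval_rec_PrimSucE: "eval_rec (Prim f g) (Suc n # xs) y"
inductive_cases eval_rec_MinE: "eval_rec (Min f) xs y"

lemma eval_rec_deterministic: "eval_rec f xs y \<Longrightarrow> eval_rec f xs z \<Longrightarrow> y = z"
proof (induction arbitrary: z rule: eval_rec.induct)
  case (1 xs)
  then show ?case by (rule eval_rec_ZeroE) simp
next
  case (2 x)
  then show ?case by (rule eval_rec_SuccE) simp
next
  case (3 i xs)
  from 3(2) show ?case by (rule eval_rec_ProjE) simp
next
  case (4 xs gs ys f y)
  from 4(4) obtain us where us: "list_all2 (\<lambda>g y. eval_rec g xs y) gs us" "eval_rec f us z"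
    by (rule eval_rec_CompE)
  have "ys = us"
  proof (rule nth_equalityI)
    show "length ys = length us"
      using 4(1) us(1) by (simp add: list_all2_conv_all_nth)
    show "ys ! i = us ! i" if "i < length ys" for i
      using 4(1) us(1) that by (simp add: list_all2_conv_all_nth)
  qed
  with us(2) have "eval_rec f ys z" by simp
  then show ?case by (rule "4.IH"(2))
next
  case (5 f xs y g)
  from 5(3) have "eval_rec f xs z" by (rule eval_rec_Prim0E)
  then show ?case by (rule "5.IH")
next
  case (6 f g n xs y w)
  from 6(5) obtain y' where y': "eval_rec (Prim f g) (n # xs) y'" "eval_rec g (n # y' # xs) z"
    by (rule eval_rec_PrimSucE)
  from "6.IH"(1)[OF y'(1)] y'(2) have "eval_rec g (n # y # xs) z" by simp
  then show ?case by (rule "6.IH"(2))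
next
  case (7 f n xs)
  from 7(4) have z: "eval_rec f (z # xs) 0" "\<forall>m<z. \<exists>y. eval_rec f (m # xs) (Suc y)"
    by (rule eval_rec_MinE, simp)+
  have "\<not> n < z" using z(2) 7(2) by (metis nat.distinct(1))
  moreover have "\<not> z < n" using 7(3) z(1) by (metis nat.distinct(1))
  ultimately show ?case by simp
qed


section \<open>Goedel numbering\<close>

fun tm_code :: "tm \<Rightarrow> nat" where
  "tm_code (Var x) = prod_encode (0, prod_encode x)"
| "tm_code (Fn f ts) = prod_encode (1, prod_encode (f, list_encode (map tm_code ts)))"

definition tms_code :: "tm list \<Rightarrow> nat" where
  "tms_code ts = list_encode (map tm_code ts)"

primrec fm_code :: "fm \<Rightarrow> nat" where
  "fm_code Falsum = list_encode [0]"
| "fm_code (Eq t u) = list_encode [1, tm_code t, tm_code u]"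
| "fm_code (Rel r ts) = list_encode [2, r, tms_code ts]"
| "fm_code (RVar X ts) = list_encode [3, fst X, list_encode (snd X), tms_code ts]"
| "fm_code (Neg \<phi>) = list_encode [4, fm_code \<phi>]"
| "fm_code (Conj \<phi> \<psi>) = list_encode [5, fm_code \<phi>, fm_code \<psi>]"
| "fm_code (Disj \<phi> \<psi>) = list_encode [6, fm_code \<phi>, fm_code \<psi>]"
| "fm_code (Impl \<phi> \<psi>) = list_encode [7, fm_code \<phi>, fm_code \<psi>]"
| "fm_code (All x \<phi>) = list_encode [8, prod_encode x, fm_code \<phi>]"
| "fm_code (Ex x \<phi>) = list_encode [9, prod_encode x, fm_code \<phi>]"
| "fm_code (Lfp X xs \<phi> ts) =
     list_encode [10, X, list_encode (map prod_encode xs), fm_code \<phi>, tms_code ts]"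

definition fms_code :: "fm list \<Rightarrow> nat" where
  "fms_code \<phi>s = list_encode (map fm_code \<phi>s)"

text \<open>Only meaningful for finite sets.\<close>

definition fm_set_code :: "fm set \<Rightarrow> nat" where
  "fm_set_code \<Gamma> = set_encode (fm_code ` \<Gamma>)"

lemma tm_code_inject: "tm_code t = tm_code u \<Longrightarrow> t = u"
proof (induction t arbitrary: u)
  case (Var x)
  then show ?case by (cases u) simp_all
next
  case (Fn f ts)
  then obtain us where u: "u = Fn f us" and *: "map tm_code ts = map tm_code us"
    by (cases u) (simp_all add: list_encode_eq)
  have "ts = us"
  proof (rule list.inj_map_strong[OF _ *])
    show "t = v" if "t \<in> set ts" "v \<in> set us" "tm_code t = tm_code v" for t v
      using Fn.IH[OF that(1) that(3)] .
  qed
  with u show ?case by simp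
qed

lemma tm_code_eq [simp]: "tm_code t = tm_code u \<longleftrightarrow> t = u"
  using tm_code_inject by blast

lemma tms_code_eq [simp]: "tms_code ts = tms_code us \<longleftrightarrow> ts = us"
  unfolding tms_code_def list_encode_eq by (rule inj_map_eq_map) (simp add: inj_def)

lemma fm_code_inject: "fm_code \<phi> = fm_code \<psi> \<Longrightarrow> \<phi> = \<psi>"
proof (induction \<phi> arbitrary: \<psi>)
  case Falsum then show ?case by (cases \<psi>) (simp_all add: list_encode_eq del: list_encode.simps)
next
  case (Eq t u) then show ?case by (cases \<psi>) (simp_all add: list_encode_eq del: list_encode.simps)
next
  case (Rel r ts) then show ?case by (cases \<psi>) (simp_all add: list_encode_eq del: list_encode.simps)
next
  case (RVar X ts) then show ?case by (cases \<psi>) (auto simp: list_encode_eq intro: prod_eqI simp del: list_encode.simps)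
next
  case (Neg \<phi>) from Neg.prems show ?case by (cases \<psi>) (auto simp: list_encode_eq simp del: list_encode.simps dest: Neg.IH)
next
  case (Conj \<phi>1 \<phi>2) from Conj.prems show ?case by (cases \<psi>) (auto simp: list_encode_eq simp del: list_encode.simps dest: Conj.IH)
next
  case (Disj \<phi>1 \<phi>2) from Disj.prems show ?case by (cases \<psi>) (auto simp: list_encode_eq simp del: list_encode.simps dest: Disj.IH)
next
  case (Impl \<phi>1 \<phi>2) from Impl.prems show ?case by (cases \<psi>) (auto simp: list_encode_eq simp del: list_encode.simps dest: Impl.IH)
next
  case (All x \<phi>) from All.prems show ?case by (cases \<psi>) (auto simp: list_encode_eq simp del: list_encode.simps dest: All.IH)
next
  case (Ex x \<phi>) from Ex.prems show ?case by (cases \<psi>) (auto simp: list_encode_eq simp del: list_encode.simps dest: Ex.IH)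
next
  case (Lfp X xs \<phi> ts)
  from Lfp.prems show ?case
    by (cases \<psi>) (auto simp: list_encode_eq inj_map_eq_map[OF inj_prod_encode] simp del: list_encode.simps dest: Lfp.IH)
qed

section \<open>Proof systems and deductive closure\<close>

text \<open>A proof system is a set of rule instances: the pair of \<open>\<phi>s\<close> and \<open>\<phi>\<close> allows one to pass from the
  premises \<open>\<phi>s\<close> to the conclusion \<open>\<phi>\<close>; axioms are instances without premises.\<close>

type_synonym proof_system = "(fm list \<times> fm) set"

definition derivation :: "proof_system \<Rightarrow> fm set \<Rightarrow> fm list \<Rightarrow> bool" where
  "derivation P \<Gamma> d \<longleftrightarrow>
     (\<forall>i<length d. d ! i \<in> \<Gamma> \<or> (\<exists>\<phi>s. (\<phi>s, d ! i) \<in> P \<and> set \<phi>s \<subseteq> set (take i d)))"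

definition derivable :: "proof_system \<Rightarrow> fm set \<Rightarrow> fm \<Rightarrow> bool" where
  "derivable P \<Gamma> \<phi> \<longleftrightarrow> (\<exists>d. derivation P \<Gamma> d \<and> d \<noteq> [] \<and> last d = \<phi>)"

definition Cn :: "proof_system \<Rightarrow> fm set \<Rightarrow> fm set" where
  "Cn P \<Gamma> = {\<phi>. derivable P \<Gamma> \<phi>}"

definition effective_proof_system :: "signature \<Rightarrow> proof_system \<Rightarrow> bool" where
  "effective_proof_system \<Sigma> P \<longleftrightarrow>
     (\<forall>(\<phi>s, \<phi>)\<in>P. set \<phi>s \<subseteq> formulas \<Sigma> \<and> \<phi> \<in> formulas \<Sigma>) \<and>
     decidable {prod_encode (fms_code \<phi>s, fm_code \<phi>) | \<phi>s \<phi>. (\<phi>s, \<phi>) \<in> P}"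

definition decidable_proof_checking :: "signature \<Rightarrow> proof_system \<Rightarrow> bool" where
  "decidable_proof_checking \<Sigma> P \<longleftrightarrow>
     decidable {prod_encode (fm_set_code \<Gamma>, fms_code d) | \<Gamma> d. knowledge_base \<Sigma> \<Gamma> \<and> derivation P \<Gamma> d}"

definition decidable_entailment_within :: "proof_system \<Rightarrow> fm set \<Rightarrow> bool" where
  "decidable_entailment_within P S \<longleftrightarrow>
     decidable_on {prod_encode (fm_set_code \<Gamma>, fm_code s) | \<Gamma> s. finite \<Gamma> \<and> \<Gamma> \<subseteq> S \<and> s \<in> S}
       {prod_encode (fm_set_code \<Gamma>, fm_code s) | \<Gamma> s. finite \<Gamma> \<and> \<Gamma> \<subseteq> S \<and> s \<in> S \<and> s \<in> Cn P \<Gamma>}"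


section \<open>The canonical order and the procedure Atom\<close>

definition canonical_listing :: "(fm \<times> fm) set \<Rightarrow> fm set \<Rightarrow> fm list \<Rightarrow> bool" where
  "canonical_listing ord S ss \<longleftrightarrow>
     distinct ss \<and> set ss = S \<and> sorted_wrt (\<lambda>\<phi> \<psi>. (\<phi>, \<psi>) \<in> ord) ss"

definition effectively_listable :: "signature \<Rightarrow> (fm \<times> fm) set \<Rightarrow> bool" where
  "effectively_listable \<Sigma> ord \<longleftrightarrow>
     (\<exists>f. \<forall>S ss. knowledge_base \<Sigma> S \<longrightarrow> canonical_listing ord S ss \<longrightarrow>
        eval_rec f [fm_set_code S] (fms_code ss))"

text \<open>\<open>scan P ss A B\<close>: scanning the list \<open>ss\<close> with initial value \<open>A\<close> ends with the value \<open>B\<close>.\<close>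

inductive scan :: "proof_system \<Rightarrow> fm list \<Rightarrow> fm set \<Rightarrow> fm set \<Rightarrow> bool" for P where
  scan_Nil: "scan P [] A A"
| scan_remove: "s \<in> Cn P (A - {s}) \<Longrightarrow> scan P ss (A - {s}) B \<Longrightarrow> scan P (s # ss) A B"
| scan_keep: "s \<notin> Cn P (A - {s}) \<Longrightarrow> scan P ss A B \<Longrightarrow> scan P (s # ss) A B"

definition atom_output :: "proof_system \<Rightarrow> (fm \<times> fm) set \<Rightarrow> fm set \<Rightarrow> fm set \<Rightarrow> bool" where
  "atom_output P ord S A \<longleftrightarrow> (\<exists>ss. canonical_listing ord S ss \<and> scan P ss S A)"

definition Atom :: "proof_system \<Rightarrow> (fm \<times> fm) set \<Rightarrow> fm set \<Rightarrow> fm set" where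
  "Atom P ord S = (THE A. atom_output P ord S A)"

end

theory Submission
  imports Defs
begin

text \<open>\<open>Cn P\<close> is a closure operator: extensive, monotone and idempotent
  (\<open>Cn_extensive\<close>, \<open>Cn_mono\<close>, \<open>Cn_least\<close>). Deleting a formula
  derivable from the remaining ones therefore preserves the closure
  (\<open>Cn_remove_redundant\<close>), and induction along the scan gives closure equivalence. A
  formula that survives was underivable from the others at the moment of its test; the set only
  shrinks afterwards, so by monotonicity it stays underivable (\<open>scan_irredundant\<close>).
  Canonicality holds because a finite set has exactly one increasing enumeration in a linear order,
  and the scan of a given list is total and deterministic (\<open>scan_exists\<close>,
  \<open>scan_unique\<close>).\<close>

lemma derivation_Nil [simp]: "derivation P \<Gamma> []"
  by (simp add: derivation_def)

text \<open>Replaces the indices of \<open>derivation\<close> by a recursion on the last line, which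
  makes \<open>rev_induct\<close> applicable.\<close>

lemma derivation_snoc:
  "derivation P \<Gamma> (d @ [\<phi>]) \<longleftrightarrow>
     derivation P \<Gamma> d \<and> (\<phi> \<in> \<Gamma> \<or> (\<exists>\<phi>s. (\<phi>s, \<phi>) \<in> P \<and> set \<phi>s \<subseteq> set d))"
  by (auto simp: derivation_def less_Suc_eq nth_append)

lemma derivation_append:
  "derivation P \<Gamma> d \<Longrightarrow> derivation P \<Gamma> e \<Longrightarrow> derivation P \<Gamma> (d @ e)"
proof (induction e rule: rev_induct)
  case (snoc \<phi> e)
  then have "derivation P \<Gamma> (d @ e)"
    and "\<phi> \<in> \<Gamma> \<or> (\<exists>\<phi>s. (\<phi>s, \<phi>) \<in> P \<and> set \<phi>s \<subseteq> set (d @ e))"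
    by (auto simp: derivation_snoc)
  then show ?case
    using derivation_snoc[of P \<Gamma> "d @ e" \<phi>] by simp
qed simp

lemma Cn_iff: "\<phi> \<in> Cn P \<Gamma> \<longleftrightarrow> (\<exists>d. derivation P \<Gamma> (d @ [\<phi>]))"
proof
  assume "\<phi> \<in> Cn P \<Gamma>"
  then obtain d where "derivation P \<Gamma> d" "d \<noteq> []" "last d = \<phi>"
    by (auto simp: Cn_def derivable_def)
  then show "\<exists>d. derivation P \<Gamma> (d @ [\<phi>])"
    by (intro exI[of _ "butlast d"]) auto
next
  assume "\<exists>d. derivation P \<Gamma> (d @ [\<phi>])"
  then show "\<phi> \<in> Cn P \<Gamma>"
    by (force simp: Cn_def derivable_def)
qed

lemma Cn_extensive: "\<Gamma> \<subseteq> Cn P \<Gamma>"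
proof
  fix \<phi> assume "\<phi> \<in> \<Gamma>"
  then have "derivation P \<Gamma> ([] @ [\<phi>])"
    unfolding derivation_snoc by simp
  then show "\<phi> \<in> Cn P \<Gamma>"
    unfolding Cn_iff by blast
qed

text \<open>A rule wants all its premises among the earlier lines of one derivation, whereas
  membership in \<open>Cn\<close> supplies a separate derivation for each; concatenation merges
  them.\<close>

lemma derivation_of_premises:
  "set \<phi>s \<subseteq> Cn P \<Gamma> \<Longrightarrow> \<exists>d. derivation P \<Gamma> d \<and> set \<phi>s \<subseteq> set d"
proof (induction \<phi>s)
  case Nil
  show ?case by (intro exI[of _ "[]"]) simp
next
  case (Cons \<phi> \<phi>s)
  then obtain d e where "derivation P \<Gamma> d" "set \<phi>s \<subseteq> set d" "derivation P \<Gamma> (e @ [\<phi>])"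
    by (auto simp: Cn_iff)
  then show ?case
    by (intro exI[of _ "d @ e @ [\<phi>]"]) (auto intro: derivation_append)
qed

lemma Cn_rule:
  assumes "(\<phi>s, \<phi>) \<in> P" and "set \<phi>s \<subseteq> Cn P \<Gamma>"
  shows "\<phi> \<in> Cn P \<Gamma>"
proof -
  obtain d where "derivation P \<Gamma> d" "set \<phi>s \<subseteq> set d"
    using derivation_of_premises[OF assms(2)] by blast
  with assms(1) have "derivation P \<Gamma> (d @ [\<phi>])"
    unfolding derivation_snoc by blast
  then show ?thesis
    unfolding Cn_iff by blast
qed

lemma derivation_subset_Cn:
  "derivation P \<Delta> d \<Longrightarrow> \<Delta> \<subseteq> Cn P \<Gamma> \<Longrightarrow> set d \<subseteq> Cn P \<Gamma>"
proof (induction d rule: rev_induct)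
  case (snoc \<phi> d)
  then have d: "set d \<subseteq> Cn P \<Gamma>"
    and "\<phi> \<in> \<Gamma> \<or> \<phi> \<in> Cn P \<Gamma> \<or> (\<exists>\<phi>s. (\<phi>s, \<phi>) \<in> P \<and> set \<phi>s \<subseteq> set d)"
    by (auto simp: derivation_snoc)
  then have "\<phi> \<in> Cn P \<Gamma>"
    using Cn_extensive[of \<Gamma> P] Cn_rule[of _ \<phi> P \<Gamma>] by blast
  with d show ?case by simp
qed simp

text \<open>This is the cut property: each line of a derivation from \<Delta> is a hypothesis
  already in \<open>Cn P \<Gamma>\<close>, or follows by a rule from lines in it, and
  \<open>Cn P \<Gamma>\<close> is closed under rules.\<close>

lemma Cn_least: "\<Delta> \<subseteq> Cn P \<Gamma> \<Longrightarrow> Cn P \<Delta> \<subseteq> Cn P \<Gamma>"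
  using derivation_subset_Cn by (fastforce simp: Cn_iff)

lemma Cn_mono: "\<Delta> \<subseteq> \<Gamma> \<Longrightarrow> Cn P \<Delta> \<subseteq> Cn P \<Gamma>"
  by (rule Cn_least) (use Cn_extensive in blast)

lemma Cn_remove_redundant:
  assumes "s \<in> Cn P (A - {s})"
  shows "Cn P (A - {s}) = Cn P A"
proof
  show "Cn P (A - {s}) \<subseteq> Cn P A"
    by (rule Cn_mono) blast
  show "Cn P A \<subseteq> Cn P (A - {s})"
    by (rule Cn_least) (use assms Cn_extensive[of "A - {s}" P] in blast)
qed

lemma sorted_wrt_listing_exists:
  assumes "finite S" and "S \<subseteq> F" and "trans r" and "total_on F r"
  shows "\<exists>xs. distinct xs \<and> set xs = S \<and> sorted_wrt (\<lambda>x y. (x, y) \<in> r) xs"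
  using assms(1,2)
proof (induction S rule: finite_induct)
  case empty
  show ?case by simp
next
  case (insert x S)
  then obtain xs where xs: "distinct xs" "set xs = S" "sorted_wrt (\<lambda>x y. (x, y) \<in> r) xs"
    by auto
  \<comment> \<open>Insert \<open>x\<close> by splitting \<open>xs\<close> into what is below
    \<open>x\<close> and the rest; totality puts \<open>x\<close> below the rest, and transitivity
    through \<open>x\<close> relates the two halves.\<close>
  define lo hi where "lo = filter (\<lambda>y. (y, x) \<in> r) xs" and "hi = filter (\<lambda>y. (y, x) \<notin> r) xs"
  have lo: "(y, x) \<in> r" if "y \<in> set lo" for y
    using that by (simp add: lo_def)
  have hi: "(x, z) \<in> r" if "z \<in> set hi" for z
  proof -
    have "z \<in> F" "x \<in> F" "x \<noteq> z" "(z, x) \<notin> r"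
      using that insert.hyps insert.prems xs(2) by (auto simp: hi_def)
    then show ?thesis
      using assms(4) by (auto simp: total_on_def)
  qed
  have "(y, z) \<in> r" if "y \<in> set lo" "z \<in> set hi" for y z
    using assms(3) lo[OF that(1)] hi[OF that(2)] by (rule transD)
  moreover have "sorted_wrt (\<lambda>x y. (x, y) \<in> r) lo" "sorted_wrt (\<lambda>x y. (x, y) \<in> r) hi"
    unfolding lo_def hi_def by (intro sorted_wrt_filter xs(3))+
  ultimately have "sorted_wrt (\<lambda>x y. (x, y) \<in> r) (lo @ x # hi)"
    using lo hi by (simp add: sorted_wrt_append)
  moreover have "distinct (lo @ x # hi)" "set (lo @ x # hi) = insert x S"
    using xs insert.hyps by (auto simp: lo_def hi_def)
  ultimately show ?case by blast
qed

text \<open>If the heads differed, each would occur in the tail of the other list, so they would be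
  related both ways, against antisymmetry.\<close>

lemma sorted_wrt_listing_unique:
  assumes "antisym r"
  shows "distinct xs \<Longrightarrow> distinct ys \<Longrightarrow> set xs = set ys \<Longrightarrow>
    sorted_wrt (\<lambda>x y. (x, y) \<in> r) xs \<Longrightarrow> sorted_wrt (\<lambda>x y. (x, y) \<in> r) ys \<Longrightarrow> xs = ys"
proof (induction xs arbitrary: ys)
  case Nil
  then show ?case by simp
next
  case (Cons x xs)
  then obtain y ys' where ys: "ys = y # ys'"
    by (cases ys) auto
  have "x = y"
  proof (rule ccontr)
    assume "x \<noteq> y"
    then have "x \<in> set ys'" "y \<in> set xs"
      using Cons.prems(3) ys by auto
    then have "(y, x) \<in> r" "(x, y) \<in> r"
      using Cons.prems(4,5) ys by auto
    with assms \<open>x \<noteq> y\<close> show False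
      by (auto dest: antisymD)
  qed
  moreover have "xs = ys'"
    by (rule Cons.IH) (use Cons.prems ys \<open>x = y\<close> in auto)
  ultimately show ?case
    using ys by simp
qed

lemma scan_exists: "\<exists>B. scan P ss A B"
proof (induction ss arbitrary: A)
  case Nil
  show ?case by (blast intro: scan_Nil)
next
  case (Cons s ss)
  then show ?case
    by (cases "s \<in> Cn P (A - {s})") (blast intro: scan_remove scan_keep)+
qed

lemma scan_unique: "scan P ss A B \<Longrightarrow> scan P ss A C \<Longrightarrow> B = C"
proof (induction arbitrary: C rule: scan.induct)
  case (scan_Nil A)
  then show ?case by cases simp
next
  case (scan_remove s A ss B)
  \<comment> \<open>The test depends only on \<open>s\<close> and the current \<open>A\<close>, so
    its outcome in the first run excludes the other rule in the second.\<close>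
  from scan_remove.prems have "scan P ss (A - {s}) C"
    by cases (use scan_remove.hyps in auto)
  then show ?case by (rule scan_remove.IH)
next
  case (scan_keep s A ss B)
  from scan_keep.prems have "scan P ss A C"
    by cases (use scan_keep.hyps in auto)
  then show ?case by (rule scan_keep.IH)
qed

lemma scan_subset: "scan P ss A B \<Longrightarrow> B \<subseteq> A"
  by (induction rule: scan.induct) auto

lemma scan_Cn: "scan P ss A B \<Longrightarrow> Cn P B = Cn P A"
proof (induction rule: scan.induct)
  case (scan_remove s A ss B)
  then show ?case using Cn_remove_redundant by metis
qed simp_all

text \<open>Only listed formulas are ever tested, hence the assumption
  \<open>a \<in> set ss\<close>.\<close>

lemma scan_irredundant:
  "scan P ss A B \<Longrightarrow> a \<in> set ss \<Longrightarrow> a \<in> B \<Longrightarrow> a \<notin> Cn P (B - {a})"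
proof (induction rule: scan.induct)
  case (scan_Nil A)
  then show ?case by simp
next
  case (scan_remove s A ss B)
  \<comment> \<open>Since \<open>B\<close> lies inside \<open>A - {s}\<close>, \<open>a\<close> is
    not the deleted \<open>s\<close>; it occurs later in the list and the induction hypothesis
    applies.\<close>
  then show ?case
    using scan_subset[of P ss "A - {s}" B] by auto
next
  case (scan_keep s A ss B)
  show ?case
  proof (cases "a = s")
    case True
    \<comment> \<open>later removals only shrink the set, so by monotonicity \<open>s\<close> stays underivable\<close>
    have "Cn P (B - {s}) \<subseteq> Cn P (A - {s})"
      using scan_subset[OF scan_keep.hyps(2)] by (intro Cn_mono) blast
    with True scan_keep.hyps(1) show ?thesis by blast
  next
    case False
    with scan_keep.prems show ?thesis
      by (intro scan_keep.IH) simp_all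
  qed
qed

theorem mainTheorem2:
  fixes \<Sigma> :: signature and P :: proof_system and ord :: "(fm \<times> fm) set"
  assumes "wf_signature \<Sigma>"
    and "effective_proof_system \<Sigma> P"
    and "decidable_proof_checking \<Sigma> P"
    and "linear_order_on (formulas \<Sigma>) ord"
    and "effectively_listable \<Sigma> ord"
    and "\<forall>S. knowledge_base \<Sigma> S \<longrightarrow> decidable_entailment_within P S"
  shows "\<forall>S. knowledge_base \<Sigma> S \<longrightarrow>
    (let A = Atom P ord S in
       Cn P A = Cn P S \<and>
       (\<forall>a\<in>A. a \<notin> Cn P (A - {a})) \<and>
       (atom_output P ord S A \<and> (\<forall>B. atom_output P ord S B \<longrightarrow> B = A)))"
proof (intro allI impI)
  fix S assume "knowledge_base \<Sigma> S"
  then have S: "finite S" "S \<subseteq> formulas \<Sigma>"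
    by (auto simp: knowledge_base_def)
  have ord: "trans ord" "antisym ord" "total_on (formulas \<Sigma>) ord"
    using assms(4)
    by (auto simp: linear_order_on_def partial_order_on_def preorder_on_def)
  obtain ss where ss: "canonical_listing ord S ss"
    using sorted_wrt_listing_exists[OF S ord(1,3)] by (auto simp: canonical_listing_def)
  obtain A where scan: "scan P ss S A"
    using scan_exists by blast
  have out: "atom_output P ord S A"
    using ss scan by (auto simp: atom_output_def)
  have unique: "B = A" if B: "atom_output P ord S B" for B
  proof -
    obtain us where us: "canonical_listing ord S us" "scan P us S B"
      using B by (auto simp: atom_output_def)
    have "us = ss"
      using us(1) ss by (intro sorted_wrt_listing_unique[OF ord(2)]) (auto simp: canonical_listing_def)
    with us(2) have "scan P ss S B" by simp
    then show ?thesis using scan by (rule scan_unique)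
  qed
  \<comment> \<open>Existence and uniqueness of the output make the definite description in
    \<open>Atom\<close> denote \<open>A\<close>.\<close>
  have "Atom P ord S = A"
    unfolding Atom_def using out unique by (rule the_equality)
  moreover have "a \<notin> Cn P (A - {a})" if "a \<in> A" for a
  proof (rule scan_irredundant[OF scan _ that])
    \<comment> \<open>The listing exhausts \<open>S\<close> and the output is a subset of
      \<open>S\<close>, so every survivor was tested.\<close>
    show "a \<in> set ss"
      using scan_subset[OF scan] ss that by (auto simp: canonical_listing_def)
  qed
  ultimately show "let A = Atom P ord S in
       Cn P A = Cn P S \<and>
       (\<forall>a\<in>A. a \<notin> Cn P (A - {a})) \<and>
       (atom_output P ord S A \<and> (\<forall>B. atom_output P ord S B \<longrightarrow> B = A))"
    unfolding Let_def using scan_Cn[OF scan] out unique by blast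
qed

end
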